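(* There is a universal constant $C<\infty$ such that the following holds. Let $\alpha\in(0,1]$, let $\phi\in C^\alpha(\mathbb{T})$ be real valued, let $\gamma>0$, and let $\omega\in\mathbb{T}$ satisfy the Diophantine condition $$\|k\omega\|\ \ge\ \frac{\gamma}{|k|\,\log^2(|k|+1)}\qquad\text{for all }k\in\mathbb{Z}\setminus\{0\}.$$ Then for all integers $N\ge 2$, $$\left\|\frac1N\,\phi^{(N)}-\int_{\mathbb{T}}\phi\right\|_\infty\ \le\ C\left(\frac1\gamma\log\frac1\gamma\right)\|\phi\|_\alpha\,\frac{\log^{3\alpha}N}{N^\alpha},$$ where $\phi^{(N)}$ denotes the $N$-th Birkhoff sum of $\phi$ over the translation $T_\omega x=x+\omega$.
   Context: $\mathbb{T}=\mathbb{R}/\mathbb{Z}$ is endowed with Lebesgue (Haar) probability measure; all integrals are with respect to it. For $t\in\mathbb{R}$, $\|t\|:=\operatorname{dist}(t,\mathbb{Z})$; the distance on $\mathbb{T}$ is $d(x,y)=\|x-y\|$. The translation is $T_\omega:\mathbb{T}\to\mathbb{T}$, $T_\omega x=x+\omega$, and $\phi^{(N)}(x):=\sum_{j=0}^{N-1}\phi(T_\omega^j x)=\sum_{j=0}^{N-1}\phi(x+j\omega)$. For $\alpha\in(0,1]$, $C^\alpha(\mathbb{T})$ is the space of $\alpha$-Hölder continuous functions with norm $\|\phi\|_\alpha:=\|\phi\|_\infty+\sup_{x\ne y}\frac{|\phi(x)-\phi(y)|}{d(x,y)^\alpha}$. $\|\cdot\|_\infty$ is the sup norm and $\log$ is the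 natural logarithm. "Universal constant" means one independent of $\alpha,\phi,\gamma,\omega,N$. *)

theory Defs
  imports "HOL-Analysis.Analysis"
begin

text \<open>
  The circle R/Z is represented through its universal cover: its points are given by real
  representatives, functions on it are the 1-periodic functions on the reals, and integration
  against its Haar probability measure is Lebesgue integration over the fundamental domain
  [0,1).
\<close>

definition circle_norm :: "real \<Rightarrow> real" where
  "circle_norm t = infdist t \<int>"

definition circle_dist :: "real \<Rightarrow> real \<Rightarrow> real" where
  "circle_dist x y = circle_norm (x - y)"

definition circle_fun :: "(real \<Rightarrow> real) \<Rightarrow> bool" where
  "circle_fun \<phi> \<longleftrightarrow> (\<forall>x. \<phi> (x + 1) = \<phi> x)"

definition circle_integral :: "(real \<Rightarrow> real) \<Rightarrow> real" where
  "circle_integral \<phi> = (LINT x:{0..<1}|lborel. \<phi> x)"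

text \<open>
  The two suprema below are real-valued, hence meaningful only when the set is bounded above;
  this is the case for all functions in \<open>holder_space\<close>.  The condition \<open>x - y \<notin> \<int>\<close>
  says that x and y represent distinct points of the circle.
\<close>

definition sup_norm :: "(real \<Rightarrow> real) \<Rightarrow> real" where
  "sup_norm \<phi> = (SUP x. \<bar>\<phi> x\<bar>)"

definition holder_seminorm :: "real \<Rightarrow> (real \<Rightarrow> real) \<Rightarrow> real" where
  "holder_seminorm \<alpha> \<phi> =
     Sup {\<bar>\<phi> x - \<phi> y\<bar> / circle_dist x y powr \<alpha> | x y. x - y \<notin> \<int>}"

definition holder_norm :: "real \<Rightarrow> (real \<Rightarrow> real) \<Rightarrow> real" where
  "holder_norm \<alpha> \<phi> = sup_norm \<phi> + holder_seminorm \<alpha> \<phi>"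

definition holder_space :: "real \<Rightarrow> (real \<Rightarrow> real) set" where
  "holder_space \<alpha> =
     {\<phi>. circle_fun \<phi> \<and> (\<exists>K. \<forall>x y. \<bar>\<phi> x - \<phi> y\<bar> \<le> K * circle_dist x y powr \<alpha>)}"

definition translation :: "real \<Rightarrow> real \<Rightarrow> real" where
  "translation \<omega> x = x + \<omega>"

definition birkhoff_sum :: "real \<Rightarrow> (real \<Rightarrow> real) \<Rightarrow> nat \<Rightarrow> real \<Rightarrow> real" where
  "birkhoff_sum \<omega> \<phi> N x = (\<Sum>j<N. \<phi> ((translation \<omega> ^^ j) x))"

definition diophantine :: "real \<Rightarrow> real \<Rightarrow> bool" where
  "diophantine \<gamma> \<omega> \<longleftrightarrow>
     (\<forall>k::int. k \<noteq> 0 \<longrightarrow>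
        circle_norm (of_int k * \<omega>)
          \<ge> \<gamma> / (\<bar>of_int k\<bar> * (ln (\<bar>of_int k\<bar> + 1))\<^sup>2))"

end

theory Submission
  imports Defs
begin

text \<open>
  If q is the denominator of an approximation of \<open>\<omega>\<close> with error at most 1/q^2, then every
  Birkhoff sum of length q is within \<open>2 H q^(1 - \<alpha>)\<close> of q times the mean, H being the Hoelder
  seminorm (Denjoy--Koksma).  A greedy Ostrowski-type expansion reduces a general length to such
  q: Dirichlet's theorem with bound M gives \<open>q \<le> M\<close>, the Diophantine condition bounds b in
  M = b q + r by \<open>ln^2 (M + 1) / \<gamma>\<close>, and \<open>r \<le> M / 2\<close>, so there are O(ln N) steps.
  The errors \<open>b q^(1 - \<alpha>) = (b q)^(1 - \<alpha>) b^\<alpha>\<close> are added up by the superadditivity of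
  \<open>(x, y) \<mapsto> x^(1 - \<alpha>) y^\<alpha>\<close>; estimating each of them by \<open>N^(1 - \<alpha>) b^\<alpha>\<close> would
  only give the exponent \<open>1 + 2 \<alpha>\<close> of the logarithm instead of \<open>3 \<alpha>\<close>.
\<close>

section \<open>Orbits, Birkhoff sums and functions on the circle\<close>

lemma translation_funpow: "(translation \<omega> ^^ j) x = x + real j * \<omega>"
  by (induction j) (auto simp: translation_def algebra_simps)

lemma birkhoff_sum_eq: "birkhoff_sum \<omega> \<phi> N x = (\<Sum>j<N. \<phi> (x + real j * \<omega>))"
  by (simp add: birkhoff_sum_def translation_funpow)

lemma birkhoff_sum_add:
  "birkhoff_sum \<omega> \<phi> (m + n) x = birkhoff_sum \<omega> \<phi> m x + birkhoff_sum \<omega> \<phi> n (x + real m * \<omega>)"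
proof (induction n)
  case (Suc n)
  then show ?case
    by (simp add: birkhoff_sum_eq algebra_simps)
qed (simp add: birkhoff_sum_eq)

lemma circle_norm_le: "circle_norm t \<le> \<bar>t - of_int n\<bar>"
  unfolding circle_norm_def by (metis Ints_of_int dist_real_def infdist_le)

lemma circle_norm_pos: "t \<notin> \<int> \<Longrightarrow> 0 < circle_norm t"
  unfolding circle_norm_def
  by (metis Ints_0 closed_Ints empty_iff in_closed_iff_infdist_zero infdist_nonneg less_eq_real_def)

lemma circle_norm_le_half: "circle_norm t \<le> 1 / 2"
  using circle_norm_le[of t "round t"] of_int_round_abs_le[of t] by (simp add: abs_minus_commute)

lemma circle_fun_add_int:
  assumes "circle_fun \<phi>"
  shows "\<phi> (x + of_int n) = \<phi> x"
proof (induction n)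
  case (nonneg n)
  show ?case
  proof (induction n)
    case (Suc n)
    have "\<phi> (x + real n + 1) = \<phi> (x + real n)"
      using assms unfolding circle_fun_def by blast
    with Suc show ?case by (simp add: add.commute add.left_commute)
  qed simp
next
  \<comment> \<open>This case is about the integer \<open>- int (Suc n)\<close>: its base is the
    shift by -1, and its step passes from -(n + 1) to -(n + 2).\<close>
  case (neg n)
  show ?case
  proof (induction n)
    case 0
    have "\<phi> (x - 1 + 1) = \<phi> (x - 1)"
      using assms unfolding circle_fun_def by blast
    then show ?case by simp
  next
    case (Suc n)
    have "\<phi> (x - real n - 2 + 1) = \<phi> (x - real n - 2)"
      using assms unfolding circle_fun_def by blast
    with Suc show ?case by (simp add: algebra_simps)
  qed
qed

section \<open>The Hoelder seminorm, the norm and continuity\<close>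

text \<open>Turns the supremum into a usable inequality. The circle distance is relaxed to \<bar>x -
  y\<bar>, since all later comparisons are between real representatives at most 1/q apart.\<close>

lemma holder_seminorm_bound:
  assumes \<phi>: "\<phi> \<in> holder_space \<alpha>" and "0 < \<alpha>"
  shows "0 \<le> holder_seminorm \<alpha> \<phi>"
    and "\<bar>\<phi> x - \<phi> y\<bar> \<le> holder_seminorm \<alpha> \<phi> * \<bar>x - y\<bar> powr \<alpha>"
proof -
  obtain K where K: "\<And>x y. \<bar>\<phi> x - \<phi> y\<bar> \<le> K * circle_dist x y powr \<alpha>" and per: "circle_fun \<phi>"
    using \<phi> by (auto simp: holder_space_def)
  let ?S = "{\<bar>\<phi> x - \<phi> y\<bar> / circle_dist x y powr \<alpha> | x y. x - y \<notin> \<int>}"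
  have pos: "circle_dist x y > 0" if "x - y \<notin> \<int>" for x y
    using circle_norm_pos[OF that] by (simp add: circle_dist_def)
  have bdd: "bdd_above ?S"
  proof (rule bdd_aboveI[of _ K])
    fix s assume "s \<in> ?S"
    then obtain x y where "x - y \<notin> \<int>" "s = \<bar>\<phi> x - \<phi> y\<bar> / circle_dist x y powr \<alpha>" by blast
    with K[of x y] pos[of x y] show "s \<le> K" by (simp add: divide_le_eq)
  qed
  have up: "\<bar>\<phi> x - \<phi> y\<bar> / circle_dist x y powr \<alpha> \<le> holder_seminorm \<alpha> \<phi>" if "x - y \<notin> \<int>" for x y
    unfolding holder_seminorm_def by (rule cSup_upper[OF _ bdd]) (use that in blast)
  \<comment> \<open>Any pair of distinct points will do: its quotient is nonnegative and lies below
    the supremum.\<close>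
  have "(1/2::real) - 0 \<notin> \<int>"
    using Ints_nonzero_abs_ge1[of "1/2::real"] by auto
  from up[OF this] show nonneg: "0 \<le> holder_seminorm \<alpha> \<phi>"
    by (smt (verit, best) divide_nonneg_nonneg powr_ge_zero abs_ge_zero)
  show "\<bar>\<phi> x - \<phi> y\<bar> \<le> holder_seminorm \<alpha> \<phi> * \<bar>x - y\<bar> powr \<alpha>"
  proof (cases "x - y \<in> \<int>")
    \<comment> \<open>Here x and y are the same point of the circle, a pair left out of the
      supremum; periodicity makes the left side 0.\<close>
    case True
    then obtain n where "x - y = of_int n" by (auto elim: Ints_cases)
    then have "x = y + of_int n" by simp
    with circle_fun_add_int[OF per, of y n] nonneg show ?thesis by simp
  next
    case False
    have "\<bar>\<phi> x - \<phi> y\<bar> \<le> holder_seminorm \<alpha> \<phi> * circle_dist x y powr \<alpha>"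
      using up[OF False] pos[OF False] by (simp add: divide_le_eq)
    also have "\<dots> \<le> holder_seminorm \<alpha> \<phi> * \<bar>x - y\<bar> powr \<alpha>"
      using circle_norm_le[of "x - y" 0] pos[OF False] nonneg \<open>0 < \<alpha>\<close>
      by (intro mult_left_mono powr_mono2) (auto simp: circle_dist_def)
    finally show ?thesis .
  qed
qed

text \<open>Amounts to \<open>sup_norm\<close> being nonnegative, which for a real-valued
  \<open>SUP\<close> requires boundedness; this comes from comparing \<phi> with its value at 0 on
  the fundamental domain.\<close>

lemma holder_seminorm_le_norm:
  assumes \<phi>: "\<phi> \<in> holder_space \<alpha>" and "0 < \<alpha>"
  shows "holder_seminorm \<alpha> \<phi> \<le> holder_norm \<alpha> \<phi>"
proof -
  let ?H = "holder_seminorm \<alpha> \<phi>"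
  have per: "circle_fun \<phi>"
    using \<phi> by (auto simp: holder_space_def)
  have "\<bar>\<phi> x\<bar> \<le> \<bar>\<phi> 0\<bar> + ?H" for x
  proof -
    have "\<phi> x = \<phi> (frac x)"
      using circle_fun_add_int[OF per, of "frac x" "floor x"] by (simp add: frac_def)
    moreover have "\<bar>\<phi> (frac x) - \<phi> 0\<bar> \<le> ?H * \<bar>frac x - 0\<bar> powr \<alpha>"
      by (rule holder_seminorm_bound(2)[OF assms])
    moreover have "\<bar>frac x - 0\<bar> powr \<alpha> \<le> 1"
      using frac_lt_1[of x] \<open>0 < \<alpha>\<close> by (intro powr_le1) auto
    then have "?H * \<bar>frac x - 0\<bar> powr \<alpha> \<le> ?H"
      using holder_seminorm_bound(1)[OF assms] mult_left_le by blast
    ultimately show ?thesis by linarith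
  qed
  then have "bdd_above (range (\<lambda>x. \<bar>\<phi> x\<bar>))"
    by (auto intro!: bdd_aboveI)
  then have "\<bar>\<phi> 0\<bar> \<le> sup_norm \<phi>"
    unfolding sup_norm_def by (rule cSUP_upper[rotated]) simp
  then show ?thesis
    by (simp add: holder_norm_def)
qed

lemma holder_continuous:
  fixes \<phi> :: "real \<Rightarrow> real"
  assumes "0 < \<alpha>" and H: "\<And>x y. \<bar>\<phi> x - \<phi> y\<bar> \<le> H * \<bar>x - y\<bar> powr \<alpha>"
  shows "continuous_on S \<phi>"
proof -
  have "isCont \<phi> x" for x
  proof -
    have "((\<lambda>y. H * \<bar>y - x\<bar> powr \<alpha>) \<longlongrightarrow> H * \<bar>x - x\<bar> powr \<alpha>) (at x)"
      \<comment> \<open>The base of the power tends to 0, so the limit rule needs the exponent to be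
        positive.\<close>
      using \<open>0 < \<alpha>\<close> by (intro tendsto_intros tendsto_powr') auto
    then have "((\<lambda>y. H * \<bar>y - x\<bar> powr \<alpha>) \<longlongrightarrow> 0) (at x)"
      using \<open>0 < \<alpha>\<close> by simp
    then have "((\<lambda>y. \<phi> y - \<phi> x) \<longlongrightarrow> 0) (at x)"
      by (rule Lim_null_comparison[rotated]) (use H in auto)
    then show ?thesis
      by (simp add: isCont_def LIM_zero_iff)
  qed
  then show ?thesis
    by (simp add: continuous_at_imp_continuous_on)
qed

section \<open>Integrals over short arcs\<close>

lemma set_integral_split_equal:
  fixes \<phi> :: "real \<Rightarrow> real"
  assumes "continuous_on UNIV \<phi>" "0 \<le> d"
  shows "(LINT t:{0..<real k * d}|lborel. \<phi> t)
       = (\<Sum>j<k. LINT t:{real j * d..<real (Suc j) * d}|lborel. \<phi> t)"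
proof -
  have int: "set_integrable lborel {a..<b} \<phi>" for a b
  proof (rule set_integrable_subset)
    show "set_integrable lborel {a..b} \<phi>"
      using assms(1) by (intro borel_integrable_atLeastAtMost') (rule continuous_on_subset, auto)
  qed auto
  show ?thesis
  proof (induction k)
    case (Suc k)
    have "{0..<real (Suc k) * d} = {0..<real k * d} \<union> {real k * d..<real (Suc k) * d}"
      using assms(2) by (intro ivl_disj_un_two(3)[symmetric]) (auto simp: algebra_simps)
    moreover have "{0..<real k * d} \<inter> {real k * d..<real (Suc k) * d} = {}"
      by auto
    ultimately show ?case
      using Suc int by (simp only: set_integral_Un sum.lessThan_Suc)
  qed (simp add: set_lebesgue_integral_def)
qed

text \<open>Used on an arc of length 1/q to replace the integral by the length times a single value
  of \<phi>; it follows by integrating c - e \<le> \<phi> \<le> c + e.\<close>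

lemma set_integral_minus_const_bound:
  fixes \<phi> :: "real \<Rightarrow> real"
  assumes "set_integrable lborel {a..<b} \<phi>" "a \<le> b" "\<And>t. t \<in> {a..<b} \<Longrightarrow> \<bar>\<phi> t - c\<bar> \<le> e"
  shows "\<bar>(LINT t:{a..<b}|lborel. \<phi> t) - (b - a) * c\<bar> \<le> (b - a) * e"
proof -
  have ci: "set_integrable lborel {a..<b} (\<lambda>_. r)" for r :: real
    using assms(2) by (auto simp: set_integrable_def)
  have cv: "(LINT t:{a..<b}|lborel. r) = (b - a) * r" for r :: real
    using assms(2) by (subst set_integral_const) auto
  have b: "c - e \<le> \<phi> t \<and> \<phi> t \<le> c + e" if "t \<in> {a..<b}" for t
    using assms(3)[OF that] by linarith
  have "(LINT t:{a..<b}|lborel. \<phi> t) \<le> (LINT t:{a..<b}|lborel. c + e)"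
    by (intro set_integral_mono assms(1) ci) (use b in auto)
  moreover have "(LINT t:{a..<b}|lborel. c - e) \<le> (LINT t:{a..<b}|lborel. \<phi> t)"
    by (intro set_integral_mono assms(1) ci) (use b in auto)
  ultimately show ?thesis
    by (simp add: cv algebra_simps abs_le_iff)
qed

section \<open>Rational rotations and the Denjoy--Koksma estimate\<close>

text \<open>As h is invertible modulo q, the map is injective, and an injective self-map of a finite
  set is onto.\<close>

lemma bij_betw_affine_mod:
  fixes h m :: int and q :: nat
  assumes "0 < q" "coprime h (int q)"
  shows "bij_betw (\<lambda>j. nat ((m + int j * h) mod int q)) {..<q} {..<q}"
proof -
  have "inj_on (\<lambda>j. nat ((m + int j * h) mod int q)) {..<q}"
  proof (rule inj_onI)
    fix i j assume ij: "i \<in> {..<q}" "j \<in> {..<q}"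
      and eq: "nat ((m + int i * h) mod int q) = nat ((m + int j * h) mod int q)"
    then have "(m + int i * h) mod int q = (m + int j * h) mod int q"
      using assms(1) by (simp add: eq_nat_nat_iff)
    then have "int q dvd (m + int i * h) - (m + int j * h)"
      by (rule mod_eq_dvd_iff[THEN iffD1])
    then have "int q dvd (int i - int j) * h"
      by (simp add: algebra_simps)
    then have "int q dvd int i - int j"
      using assms(2) by (simp add: coprime_commute coprime_dvd_mult_left_iff)
    then have "int i mod int q = int j mod int q"
      by (simp add: mod_eq_dvd_iff)
    with ij show "i = j" by simp
  qed
  moreover have "(\<lambda>j. nat ((m + int j * h) mod int q)) ` {..<q} \<subseteq> {..<q}"
    using assms(1) by (auto simp: nat_less_iff)
  ultimately show ?thesis
    by (simp add: bij_betw_def endo_inj_surj)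
qed

text \<open>With q x = frac (q x) + m, the j-th point is (frac (q x) + m + j h) / q. Dividing m + j
  h by q leaves a remainder that selects the arc and a quotient that is an integer shift, invisible
  to \<phi>; the remainders run through all arcs once.\<close>

lemma sum_rational_rotation:
  assumes "circle_fun \<phi>" "0 < q" "coprime h (int q)"
  shows "(\<Sum>j<q. \<phi> (x + real j * (of_int h / real q)))
       = (\<Sum>j<q. \<phi> (frac (real q * x) / real q + real j / real q))"
proof -
  define m where "m = \<lfloor>real q * x\<rfloor>"
  let ?g = "\<lambda>j. nat ((m + int j * h) mod int q)"
  have "\<phi> (x + real j * (of_int h / real q))
      = \<phi> (frac (real q * x) / real q + real (?g j) / real q)" for j
  proof -
    let ?a = "m + int j * h"
    have r: "real (?g j) = of_int (?a mod int q)"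
      using assms(2) by simp
    have "real_of_int ?a = of_int (?a div int q * int q + ?a mod int q)"
      by simp
    then have a: "real_of_int ?a = of_int (?a div int q) * real q + of_int (?a mod int q)"
      by (simp only: of_int_add of_int_mult of_int_of_nat_eq)
    have "real q * x = frac (real q * x) + of_int m"
      by (simp add: frac_def m_def)
    then have "real q * x + real j * of_int h
        = frac (real q * x) + of_int (?a div int q) * real q + real (?g j)"
      using a r by simp
    then have "x + real j * (of_int h / real q)
        = frac (real q * x) / real q + real (?g j) / real q + of_int (?a div int q)"
      using assms(2) by (simp add: field_simps)
    then show ?thesis
      using circle_fun_add_int[OF assms(1)] by metis
  qed
  then show ?thesis
    using sum.reindex_bij_betw[OF bij_betw_affine_mod[OF assms(2,3), of m],
        of "\<lambda>j. \<phi> (frac (real q * x) / real q + real j / real q)"] by simp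
qed

text \<open>
  Up to a shift of at most 1/q, the first q points of the orbit are one per arc of length 1/q.
\<close>

lemma birkhoff_sum_denominator:
  fixes \<phi> :: "real \<Rightarrow> real"
  assumes per: "circle_fun \<phi>" and "0 < \<alpha>" "0 \<le> H"
    and H: "\<And>x y. \<bar>\<phi> x - \<phi> y\<bar> \<le> H * \<bar>x - y\<bar> powr \<alpha>"
    and "0 < q" "coprime h (int q)" and approx: "\<bar>real q * \<omega> - of_int h\<bar> \<le> 1 / real q"
  shows "\<bar>birkhoff_sum \<omega> \<phi> q x - real q * circle_integral \<phi>\<bar> \<le> 2 * H * real q powr (1 - \<alpha>)"
proof -
  \<comment> \<open>Bounds the change of \<phi> over a distance 1/q. Two errors of q e each arise,
    one from replacing \<omega> by h/q and one from replacing the integral by a sum; hence the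
    factor 2.\<close>
  define e where "e = H * (1 / real q) powr \<alpha>"
  have q: "real q > 0" using \<open>0 < q\<close> by simp
  have close: "\<bar>\<phi> s - \<phi> t\<bar> \<le> e" if "\<bar>s - t\<bar> \<le> 1 / real q" for s t
  proof -
    have "\<bar>s - t\<bar> powr \<alpha> \<le> (1 / real q) powr \<alpha>"
      using that \<open>0 < \<alpha>\<close> by (intro powr_mono2) auto
    then show ?thesis
      using H[of s t] \<open>0 \<le> H\<close> unfolding e_def by (meson mult_left_mono order_trans)
  qed
  let ?x0 = "frac (real q * x) / real q"
  have cont: "continuous_on S \<phi>" for S
    using \<open>0 < \<alpha>\<close> H by (rule holder_continuous)
  have int: "set_integrable lborel {a..<b} \<phi>" for a b
  proof (rule set_integrable_subset)
    show "set_integrable lborel {a..b} \<phi>"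
      by (intro borel_integrable_atLeastAtMost' cont)
  qed auto
  \<comment> \<open>Replacing \<omega> by h/q moves the j-th point by j/q times the error of q
    \<omega>, thus by at most 1/q because j < q.\<close>
  have A: "\<bar>(\<Sum>j<q. \<phi> (x + real j * \<omega>)) - (\<Sum>j<q. \<phi> (x + real j * (of_int h / real q)))\<bar>
      \<le> (\<Sum>j<q. e)"
    unfolding sum_subtractf[symmetric]
  proof (rule order_trans[OF sum_abs], rule sum_mono, rule close)
    fix j assume "j \<in> {..<q}"
    then have "real j / real q \<le> 1" by simp
    have "x + real j * \<omega> - (x + real j * (of_int h / real q))
        = real j / real q * (real q * \<omega> - of_int h)"
      using q by (simp add: right_diff_distrib)
    then have "\<bar>x + real j * \<omega> - (x + real j * (of_int h / real q))\<bar>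
        = real j / real q * \<bar>real q * \<omega> - of_int h\<bar>"
      by (simp add: abs_mult)
    also have "\<dots> \<le> 1 * (1 / real q)"
      using \<open>real j / real q \<le> 1\<close> approx by (intro mult_mono) auto
    finally show "\<bar>x + real j * \<omega> - (x + real j * (of_int h / real q))\<bar> \<le> 1 / real q" by simp
  qed
  have "\<bar>real q * circle_integral \<phi> - (\<Sum>j<q. \<phi> (?x0 + real j / real q))\<bar> \<le> (\<Sum>j<q. e)"
  proof -
    have "circle_integral \<phi> = (LINT t:{0..<real q * (1 / real q)}|lborel. \<phi> t)"
      using q by (simp add: circle_integral_def)
    also have "\<dots> = (\<Sum>j<q. LINT t:{real j * (1 / real q)..<real (Suc j) * (1 / real q)}|lborel. \<phi> t)"
      by (rule set_integral_split_equal[OF cont]) simp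
    finally have "real q * circle_integral \<phi> - (\<Sum>j<q. \<phi> (?x0 + real j / real q))
        = (\<Sum>j<q. real q * (LINT t:{real j / real q..<real (Suc j) / real q}|lborel. \<phi> t)
             - \<phi> (?x0 + real j / real q))"
      by (simp add: sum_subtractf sum_distrib_left)
    also have "\<bar>\<dots>\<bar> \<le> (\<Sum>j<q. e)"
    proof (rule order_trans[OF sum_abs], rule sum_mono)
      fix j
      let ?a = "real j / real q" and ?b = "real (Suc j) / real q"
      have ab: "?b - ?a = 1 / real q" by (simp add: diff_divide_distrib[symmetric])
      \<comment> \<open>The sample point \<open>?x0 + ?a\<close> lies in the closed j-th arc, so it
        is within 1/q of every t in that arc.\<close>
      have x0: "0 \<le> ?x0" "?x0 \<le> 1 / real q"
        using q frac_lt_1[of "real q * x"] by (auto intro!: divide_right_mono)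
      have "\<bar>(LINT t:{?a..<?b}|lborel. \<phi> t) - (?b - ?a) * \<phi> (?x0 + ?a)\<bar> \<le> (?b - ?a) * e"
      proof (rule set_integral_minus_const_bound[OF int])
        fix t assume t: "t \<in> {?a..<?b}"
        then have "\<bar>t - (?x0 + ?a)\<bar> \<le> 1 / real q"
          unfolding atLeastLessThan_iff using x0 ab by linarith
        then show "\<bar>\<phi> t - \<phi> (?x0 + ?a)\<bar> \<le> e" by (rule close)
      qed (simp add: divide_right_mono)
      then have "real q * \<bar>(LINT t:{?a..<?b}|lborel. \<phi> t) - (1 / real q) * \<phi> (?x0 + ?a)\<bar>
          \<le> real q * ((1 / real q) * e)"
        unfolding ab using q by (intro mult_left_mono) auto
      moreover have "real q * \<bar>(LINT t:{?a..<?b}|lborel. \<phi> t) - (1 / real q) * \<phi> (?x0 + ?a)\<bar>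
          = \<bar>real q * ((LINT t:{?a..<?b}|lborel. \<phi> t) - (1 / real q) * \<phi> (?x0 + ?a))\<bar>"
        using q by (simp only: abs_mult abs_of_pos)
      moreover have "real q * ((LINT t:{?a..<?b}|lborel. \<phi> t) - (1 / real q) * \<phi> (?x0 + ?a))
          = real q * (LINT t:{?a..<?b}|lborel. \<phi> t) - \<phi> (?x0 + ?a)"
        using q by (simp add: right_diff_distrib)
      ultimately show "\<bar>real q * (LINT t:{?a..<?b}|lborel. \<phi> t) - \<phi> (?x0 + ?a)\<bar> \<le> e"
        using q by simp
    qed
    finally show ?thesis .
  qed
  then have "\<bar>birkhoff_sum \<omega> \<phi> q x - real q * circle_integral \<phi>\<bar> \<le> 2 * (real q * e)"
    using A unfolding birkhoff_sum_eq
      sum_rational_rotation[OF per \<open>0 < q\<close> \<open>coprime h (int q)\<close>] sum_constant card_lessThan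
    by linarith
  also have "real q * e = H * real q powr (1 - \<alpha>)"
    using q by (simp add: e_def powr_diff powr_divide)
  finally show ?thesis by simp
qed

section \<open>General lengths by greedy expansion\<close>

text \<open>Each block of length q starts at a different point of the orbit; the hypothesis is
  uniform in the starting point, so the errors just add up.\<close>

lemma birkhoff_sum_mult_bound:
  assumes "\<And>x. \<bar>birkhoff_sum \<omega> \<phi> q x - real q * I\<bar> \<le> e"
  shows "\<bar>birkhoff_sum \<omega> \<phi> (b * q) x - real (b * q) * I\<bar> \<le> real b * e"
proof (induction b)
  case (Suc b)
  have "birkhoff_sum \<omega> \<phi> (Suc b * q) x
      = birkhoff_sum \<omega> \<phi> (b * q) x + birkhoff_sum \<omega> \<phi> q (x + real (b * q) * \<omega>)"
    using birkhoff_sum_add[of \<omega> \<phi> "b * q" q x] by (simp add: add.commute)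
  with Suc assms[of "x + real (b * q) * \<omega>"] show ?case
    by (simp add: algebra_simps abs_le_iff)
qed (simp add: birkhoff_sum_eq)

text \<open>Hoelder's inequality for two terms. Young's inequality with weights 1 - \<alpha> and
  \<alpha> is applied to the normalised pairs (a/(a+b), c/(c+d)) and (b/(a+b), d/(c+d)); the two
  weighted means sum to 1.\<close>

lemma powr_mult_superadditive:
  fixes a b c d \<alpha> :: real
  assumes "0 < a" "0 < b" "0 < c" "0 < d" "0 \<le> \<alpha>" "\<alpha> \<le> 1"
  shows "a powr (1 - \<alpha>) * c powr \<alpha> + b powr (1 - \<alpha>) * d powr \<alpha>
       \<le> (a + b) powr (1 - \<alpha>) * (c + d) powr \<alpha>"
proof -
  have Y: "a' powr (1 - \<alpha>) * c' powr \<alpha>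
      \<le> ((1 - \<alpha>) * (a' / (a + b)) + \<alpha> * (c' / (c + d))) * ((a + b) powr (1 - \<alpha>) * (c + d) powr \<alpha>)"
    if "0 < a'" "0 < c'" for a' c'
    using Youngs_inequality_0[of "1 - \<alpha>" \<alpha> "a' / (a + b)" "c' / (c + d)"] assms that
    by (simp add: powr_divide divide_le_eq mult.assoc)
  have "(1 - \<alpha>) * (a / (a + b)) + \<alpha> * (c / (c + d)) + ((1 - \<alpha>) * (b / (a + b)) + \<alpha> * (d / (c + d)))
      = (1 - \<alpha>) * ((a + b) / (a + b)) + \<alpha> * ((c + d) / (c + d))"
    by (simp only: add_divide_distrib distrib_left add_ac)
  also have "\<dots> = 1"
    using assms by simp
  finally show ?thesis
    using add_mono[OF Y[of a c] Y[of b d]] assms by (simp add: distrib_right[symmetric])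
qed

text \<open>The condition at k = 1 suffices, as no point is further than 1/2 from the integers. This
  keeps ln (1 / \<gamma>) away from 0 in the final bound.\<close>

lemma diophantine_gamma_le_half:
  assumes "diophantine \<gamma> \<omega>"
  shows "\<gamma> \<le> 1 / 2"
proof -
  have "\<gamma> / (ln 2)\<^sup>2 \<le> circle_norm \<omega>"
    using assms[unfolded diophantine_def, rule_format, of 1] by simp
  also have "\<dots> \<le> 1 / 2" by (rule circle_norm_le_half)
  finally have "\<gamma> \<le> (ln 2)\<^sup>2 / 2" by (simp add: divide_le_eq)
  also have "(ln 2)\<^sup>2 \<le> (1::real)\<^sup>2"
    using ln_2_less_1 by (intro power_mono) auto
  finally show ?thesis by simp
qed

text \<open>N stays fixed while M shrinks, so the digit bound K is the same at every step; x is
  arbitrary because the remainder block starts at a shifted point. The factor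
  \<open>log 2 (real M) + 1\<close> counts the steps.\<close>

lemma birkhoff_sum_bound:
  fixes \<phi> :: "real \<Rightarrow> real"
  assumes per: "circle_fun \<phi>" and \<alpha>: "0 < \<alpha>" "\<alpha> \<le> 1" and "0 \<le> H"
    and H: "\<And>x y. \<bar>\<phi> x - \<phi> y\<bar> \<le> H * \<bar>x - y\<bar> powr \<alpha>"
    and dioph: "diophantine \<gamma> \<omega>" and "0 < \<gamma>"
    and "0 < M" "M \<le> N"
  shows "\<bar>birkhoff_sum \<omega> \<phi> M x - real M * circle_integral \<phi>\<bar>
       \<le> 2 * H * (real M powr (1 - \<alpha>) * ((ln (real N + 1))\<^sup>2 / \<gamma> * (log 2 (real M) + 1)) powr \<alpha>)"
  using \<open>0 < M\<close> \<open>M \<le> N\<close>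
proof (induction M arbitrary: x rule: less_induct)
  case (less M)
  define K where "K = (ln (real N + 1))\<^sup>2 / \<gamma>"
  have Kpos: "0 < K"
    using less.prems \<open>0 < \<gamma>\<close> by (auto simp: K_def)
  obtain h k where hk: "coprime h k" "0 < k" "k \<le> int M"
    and app: "\<bar>of_int k * \<omega> - of_int h\<bar> < 1 / real M"
    using Dirichlet_approx_coprime[OF \<open>0 < M\<close>, of \<omega>] by blast
  define q where "q = nat k"
  have q: "0 < q" "q \<le> M" "int q = k" "real q = of_int k"
    using hk by (auto simp: q_def)
  define b r where "b = M div q" and "r = M mod q"
  have M: "M = b * q + r" and "r < q" and "1 \<le> b"
    using q by (auto simp: b_def r_def Suc_le_eq div_greater_zero_iff)
  \<comment> \<open>The lower bound on the circle norm of q \<omega> against Dirichlet's upper bound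
    1/M: q cannot be much smaller than M, which bounds the digit b.\<close>
  have "\<gamma> / (real q * (ln (real q + 1))\<^sup>2) \<le> circle_norm (of_int k * \<omega>)"
    using dioph[unfolded diophantine_def, rule_format, of k] hk(2) q by simp
  also have "\<dots> \<le> 1 / real M"
    using circle_norm_le[of "of_int k * \<omega>" h] app by linarith
  finally have "\<gamma> * real M \<le> real q * (ln (real q + 1))\<^sup>2"
    using \<open>0 < M\<close> q by (simp add: field_simps)
  moreover have "real b * real q \<le> real M"
    unfolding M by simp
  ultimately have "\<gamma> * (real b * real q) \<le> real q * (ln (real q + 1))\<^sup>2"
    using \<open>0 < \<gamma>\<close> by (meson mult_left_mono order_trans less_imp_le)
  then have "\<gamma> * real b \<le> (ln (real q + 1))\<^sup>2"
    using q by (simp add: mult.left_commute)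
  also have "\<dots> \<le> (ln (real N + 1))\<^sup>2"
    using q less.prems by (intro power_mono) auto
  finally have bK: "real b \<le> K"
    using \<open>0 < \<gamma>\<close> by (simp add: K_def field_simps)
  have "1 / real M \<le> 1 / real q"
    using q by (simp add: frac_le)
  then have "\<bar>real q * \<omega> - of_int h\<bar> \<le> 1 / real q"
    using app q by simp
  then have "\<bar>birkhoff_sum \<omega> \<phi> q y - real q * circle_integral \<phi>\<bar> \<le> 2 * H * real q powr (1 - \<alpha>)" for y
    using birkhoff_sum_denominator[OF per \<open>0 < \<alpha>\<close> \<open>0 \<le> H\<close> H \<open>0 < q\<close>] hk q by simp
  then have "\<bar>birkhoff_sum \<omega> \<phi> (b * q) x - real (b * q) * circle_integral \<phi>\<bar>
      \<le> real b * (2 * H * real q powr (1 - \<alpha>))"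
    by (rule birkhoff_sum_mult_bound)
  \<comment> \<open>Writing b as b^(1 - \<alpha>) b^\<alpha> puts the error into the form that
    superadditivity can add.\<close>
  moreover have "real b * real q powr (1 - \<alpha>) = real (b * q) powr (1 - \<alpha>) * real b powr \<alpha>"
  proof -
    have "real b powr (1 - \<alpha>) * real b powr \<alpha> = real b"
      using \<open>1 \<le> b\<close> by (simp flip: powr_add)
    then show ?thesis by (simp add: powr_mult)
  qed
  ultimately have main: "\<bar>birkhoff_sum \<omega> \<phi> (b * q) x - real (b * q) * circle_integral \<phi>\<bar>
      \<le> 2 * H * (real (b * q) powr (1 - \<alpha>) * real b powr \<alpha>)"
    by (metis (no_types, opaque_lifting) mult.assoc mult.left_commute)
  show ?case
    unfolding K_def[symmetric]
  proof (cases "r = 0")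
    \<comment> \<open>The expansion ends here, and the summand 1 next to the logarithm pays for this
      last digit.\<close>
    case True
    have "0 \<le> log 2 (real M)" using \<open>0 < M\<close> by simp
    then have "K \<le> K * (log 2 (real M) + 1)"
      using Kpos by simp
    then have "real b powr \<alpha> \<le> (K * (log 2 (real M) + 1)) powr \<alpha>"
      using bK \<open>0 < \<alpha>\<close> by (intro powr_mono2) auto
    then have "2 * H * (real M powr (1 - \<alpha>) * real b powr \<alpha>)
        \<le> 2 * H * (real M powr (1 - \<alpha>) * (K * (log 2 (real M) + 1)) powr \<alpha>)"
      using \<open>0 \<le> H\<close> by (intro mult_left_mono) auto
    with main True M show "\<bar>birkhoff_sum \<omega> \<phi> M x - real M * circle_integral \<phi>\<bar>
       \<le> 2 * H * (real M powr (1 - \<alpha>) * (K * (log 2 (real M) + 1)) powr \<alpha>)"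
      by simp
  next
    case False
    then have "0 < r" by simp
    have "r < M" using \<open>r < q\<close> q by simp
    \<comment> \<open>The remainder is at most half of M, so the logarithm drops by at least 1; this
      frees one K, enough to absorb b.\<close>
    have "q \<le> b * q" using \<open>1 \<le> b\<close> by simp
    then have "2 * r \<le> M" using \<open>r < q\<close> M by linarith
    then have "log 2 (2 * real r) \<le> log 2 (real M)"
      using \<open>0 < r\<close> by (subst log_le_cancel_iff) auto
    then have lr: "log 2 (real r) + 1 \<le> log 2 (real M)"
      using \<open>0 < r\<close> by (simp add: log_mult)
    have lr0: "0 \<le> log 2 (real r)" using \<open>0 < r\<close> by simp
    let ?B = "K * (log 2 (real r) + 1)"
    have "0 < ?B" using Kpos lr0 by simp
    have IH: "\<bar>birkhoff_sum \<omega> \<phi> r y - real r * circle_integral \<phi>\<bar>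
        \<le> 2 * H * (real r powr (1 - \<alpha>) * ?B powr \<alpha>)" for y
      using less.IH[OF \<open>r < M\<close> \<open>0 < r\<close>] \<open>r < M\<close> less.prems unfolding K_def by simp
    have "real (b * q) powr (1 - \<alpha>) * real b powr \<alpha> + real r powr (1 - \<alpha>) * ?B powr \<alpha>
        \<le> (real (b * q) + real r) powr (1 - \<alpha>) * (real b + ?B) powr \<alpha>"
      using \<open>1 \<le> b\<close> q \<open>0 < r\<close> \<open>0 < ?B\<close> \<alpha> by (intro powr_mult_superadditive) auto
    also have "\<dots> \<le> real M powr (1 - \<alpha>) * (K * (log 2 (real M) + 1)) powr \<alpha>"
    proof -
      have "K * (log 2 (real r) + 1) \<le> K * log 2 (real M)"
        using lr Kpos by simp
      then have "real b + ?B \<le> K * (log 2 (real M) + 1)"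
        using bK by (simp add: distrib_left)
      moreover have "real (b * q) + real r = real M" using M by (metis of_nat_add)
      ultimately show ?thesis
        using \<open>0 < ?B\<close> \<open>0 < \<alpha>\<close> by (auto intro!: mult_left_mono powr_mono2)
    qed
    finally have C: "2 * H * (real (b * q) powr (1 - \<alpha>) * real b powr \<alpha>
          + real r powr (1 - \<alpha>) * ?B powr \<alpha>)
        \<le> 2 * H * (real M powr (1 - \<alpha>) * (K * (log 2 (real M) + 1)) powr \<alpha>)"
      using \<open>0 \<le> H\<close> by (intro mult_left_mono) auto
    have S: "birkhoff_sum \<omega> \<phi> M x
        = birkhoff_sum \<omega> \<phi> (b * q) x + birkhoff_sum \<omega> \<phi> r (x + real (b * q) * \<omega>)"
      unfolding M by (rule birkhoff_sum_add)
    have "real M * circle_integral \<phi> = real (b * q) * circle_integral \<phi> + real r * circle_integral \<phi>"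
      using M by (metis of_nat_add distrib_right)
    then show "\<bar>birkhoff_sum \<omega> \<phi> M x - real M * circle_integral \<phi>\<bar>
       \<le> 2 * H * (real M powr (1 - \<alpha>) * (K * (log 2 (real M) + 1)) powr \<alpha>)"
      using main IH[of "x + real (b * q) * \<omega>"] C S
      unfolding distrib_left by linarith
  qed
qed

section \<open>Assembling the constant\<close>

theorem theorem1:
  "\<exists>C::real. \<forall>(\<alpha>::real) (\<phi>::real \<Rightarrow> real) (\<gamma>::real) (\<omega>::real).
     0 < \<alpha> \<longrightarrow> \<alpha> \<le> 1 \<longrightarrow> \<phi> \<in> holder_space \<alpha> \<longrightarrow> 0 < \<gamma> \<longrightarrow> diophantine \<gamma> \<omega> \<longrightarrow>
     (\<forall>N::nat. 2 \<le> N \<longrightarrow>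
        sup_norm (\<lambda>x. 1 / real N * birkhoff_sum \<omega> \<phi> N x - circle_integral \<phi>)
          \<le> C * (1 / \<gamma> * ln (1 / \<gamma>)) * holder_norm \<alpha> \<phi>
              * (ln (real N) powr (3 * \<alpha>) / real N powr \<alpha>))"
\<comment> \<open>64 = 2 * 16 * 2: the Denjoy--Koksma factor, then 2^2 * 4 from bounding B by L^3,
  then 1 \<le> 2 ln (1 / \<gamma>).\<close>
proof (intro exI[of _ 64] allI impI)
  fix \<alpha> \<gamma> \<omega> :: real and \<phi> :: "real \<Rightarrow> real" and N :: nat
  assume \<alpha>: "0 < \<alpha>" "\<alpha> \<le> 1" and \<phi>: "\<phi> \<in> holder_space \<alpha>" and "0 < \<gamma>"
    and dioph: "diophantine \<gamma> \<omega>" and "2 \<le> N"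
  define H where "H = holder_seminorm \<alpha> \<phi>"
  define L where "L = ln (real N)"
  define B where "B = (ln (real N + 1))\<^sup>2 / \<gamma> * (log 2 (real N) + 1)"
  have per: "circle_fun \<phi>"
    using \<phi> by (simp add: holder_space_def)
  have H0: "0 \<le> H"
    unfolding H_def by (rule holder_seminorm_bound(1)[OF \<phi> \<open>0 < \<alpha>\<close>])
  have H: "\<bar>\<phi> x - \<phi> y\<bar> \<le> H * \<bar>x - y\<bar> powr \<alpha>" for x y
    unfolding H_def by (rule holder_seminorm_bound(2)[OF \<phi> \<open>0 < \<alpha>\<close>])
  have \<gamma>: "\<gamma> \<le> 1 / 2"
    using dioph by (rule diophantine_gamma_le_half)
  have ln2: "1 / 2 \<le> ln (2::real)"
    using ln2_ge_two_thirds by simp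
  have "ln 2 \<le> L"
    using \<open>2 \<le> N\<close> by (simp add: L_def)
  have "0 < L" using \<open>ln 2 \<le> L\<close> ln2 by linarith
  have "ln (real N + 1) \<le> ln (real N ^ 2)"
  proof -
    have "2 * N \<le> N * N" using \<open>2 \<le> N\<close> by (rule mult_right_mono) simp
    then have "N + 1 \<le> N ^ 2" using \<open>2 \<le> N\<close> unfolding power2_eq_square by linarith
    then have "real N + 1 \<le> real N ^ 2"
      by (metis of_nat_1 of_nat_add of_nat_le_iff of_nat_power)
    then show ?thesis using \<open>2 \<le> N\<close> by (subst ln_le_cancel_iff) auto
  qed
  also have "\<dots> = 2 * L"
    using \<open>2 \<le> N\<close> by (simp add: L_def ln_realpow)
  finally have l1: "(ln (real N + 1))\<^sup>2 \<le> (2 * L)\<^sup>2"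
    by (intro power_mono) auto
  \<comment> \<open>From ln 2 \<ge> 1/2 both \<open>log 2 (real N)\<close> and 1 are at most 2 L,
    the latter because L \<ge> ln 2.\<close>
  have l2: "log 2 (real N) + 1 \<le> 4 * L"
  proof -
    have "log 2 (real N) = L / ln 2" by (simp add: log_def L_def)
    also have "\<dots> \<le> L / (1 / 2)"
      using ln2 \<open>0 < L\<close> by (intro divide_left_mono) auto
    finally show ?thesis using ln2 \<open>ln 2 \<le> L\<close> by simp
  qed
  have "B \<le> (2 * L)\<^sup>2 / \<gamma> * (4 * L)"
    unfolding B_def using l1 l2 \<open>0 < \<gamma>\<close> \<open>2 \<le> N\<close> by (intro mult_mono divide_right_mono) auto
  also have "\<dots> = 16 / \<gamma> * L powr 3"
    using \<open>0 < L\<close> by (simp add: power2_eq_square power3_eq_cube)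
  finally have B: "B \<le> 16 / \<gamma> * L powr 3" .
  have B0: "0 \<le> B"
    unfolding B_def using \<open>0 < \<gamma>\<close> \<open>2 \<le> N\<close> by (intro mult_nonneg_nonneg) auto
  have "B powr \<alpha> \<le> (16 / \<gamma> * L powr 3) powr \<alpha>"
    using B B0 \<alpha> by (intro powr_mono2) auto
  also have "\<dots> = (16 / \<gamma>) powr \<alpha> * L powr (3 * \<alpha>)"
    by (simp only: powr_mult powr_powr)
  also have "\<dots> \<le> 16 / \<gamma> * L powr (3 * \<alpha>)"
  proof -
    \<comment> \<open>Only this factor loses its exponent \<alpha>, its base being at least 1; the
      power of L must keep the exponent 3 \<alpha>.\<close>
    have "1 \<le> 16 / \<gamma>" using \<gamma> \<open>0 < \<gamma>\<close> by (simp add: field_simps)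
    then have "(16 / \<gamma>) powr \<alpha> \<le> (16 / \<gamma>) powr 1"
      using \<alpha> by (intro powr_mono) auto
    then show ?thesis using \<open>0 < \<gamma>\<close> by (intro mult_right_mono) auto
  qed
  also have "\<dots> \<le> 32 * (1 / \<gamma> * ln (1 / \<gamma>)) * L powr (3 * \<alpha>)"
  proof -
    have "2 \<le> 1 / \<gamma>" using \<gamma> \<open>0 < \<gamma>\<close> by (simp add: field_simps)
    then have "ln 2 \<le> ln (1 / \<gamma>)"
      using \<open>0 < \<gamma>\<close> by (subst ln_le_cancel_iff) auto
    with ln2 have "16 \<le> 32 * ln (1 / \<gamma>)" by linarith
    then have "16 * (1 / \<gamma>) \<le> (32 * ln (1 / \<gamma>)) * (1 / \<gamma>)"
      using \<open>0 < \<gamma>\<close> by (intro mult_right_mono) auto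
    then show ?thesis by (intro mult_right_mono) (simp_all add: mult_ac)
  qed
  finally have Bp: "B powr \<alpha> \<le> 32 * (1 / \<gamma> * ln (1 / \<gamma>)) * L powr (3 * \<alpha>)" .
  show "sup_norm (\<lambda>x. 1 / real N * birkhoff_sum \<omega> \<phi> N x - circle_integral \<phi>)
      \<le> 64 * (1 / \<gamma> * ln (1 / \<gamma>)) * holder_norm \<alpha> \<phi> * (ln (real N) powr (3 * \<alpha>) / real N powr \<alpha>)"
    unfolding sup_norm_def
  proof (rule cSUP_least)
    fix x
    have N: "real N > 0" using \<open>2 \<le> N\<close> by simp
    have "1 / real N * birkhoff_sum \<omega> \<phi> N x - circle_integral \<phi>
        = (birkhoff_sum \<omega> \<phi> N x - real N * circle_integral \<phi>) / real N"
      using N by (simp add: field_simps)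
    then have "\<bar>1 / real N * birkhoff_sum \<omega> \<phi> N x - circle_integral \<phi>\<bar>
        = \<bar>birkhoff_sum \<omega> \<phi> N x - real N * circle_integral \<phi>\<bar> / real N"
      by simp
    also have "\<dots> \<le> 2 * H * (real N powr (1 - \<alpha>) * B powr \<alpha>) / real N"
      unfolding B_def using \<open>2 \<le> N\<close>
      by (intro divide_right_mono birkhoff_sum_bound[OF per \<alpha> H0 H dioph \<open>0 < \<gamma>\<close>]) auto
    also have "\<dots> = 2 * H * (B powr \<alpha> / real N powr \<alpha>)"
      using N by (simp add: powr_diff)
    also have "\<dots> \<le> 2 * holder_norm \<alpha> \<phi>
        * (32 * (1 / \<gamma> * ln (1 / \<gamma>)) * L powr (3 * \<alpha>) / real N powr \<alpha>)"
      using holder_seminorm_le_norm[OF \<phi> \<open>0 < \<alpha>\<close>, folded H_def] H0 Bp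
      by (intro mult_mono divide_right_mono) auto
    finally show "\<bar>1 / real N * birkhoff_sum \<omega> \<phi> N x - circle_integral \<phi>\<bar>
        \<le> 64 * (1 / \<gamma> * ln (1 / \<gamma>)) * holder_norm \<alpha> \<phi> * (ln (real N) powr (3 * \<alpha>) / real N powr \<alpha>)"
      by (simp add: L_def mult_ac)
  qed simp
qed

end
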